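(* Let $p\geq 5$ be a prime and let $a$ be an integer with $2\leq a\leq p-2$. Let $H$ be an admissible subgroup of order $p$ of $\mathrm{PGL}_{a}(\mathbb{C})$ in diagonal form, and let $K$ be a subgroup of order $p$ of $\mathrm{PGL}_{p-a}(\mathbb{C})$ in diagonal form associated to $H$. Let $T$ be the point set in $\mathbb{P}^{a-1}(\mathbb{C})$ consisting of the orbit of the identity point $[1,\ldots,1]$ under the action of $H$, and let $V$ be the point set in $\mathbb{P}^{p-a-1}(\mathbb{C})$ consisting of the orbit of the identity point $[1,\ldots,1]$ under the action of $K$. Then the point sets $T$ and $V$ are associated.
   Context: Admissible groups. For $m\ge1$, a set of points in $\mathbb{P}^m(\mathbb{C})$ is in general position if any subset of $t\le m+1$ of its points spans a $(t-1)$-dimensional linear projective subspace. For a finite set $T$ of points, $\mathrm{Aut}(T)=\{f\in \mathrm{PGL}_{m+1}(\mathbb{C}) : T^f=T\}$. A finite subgroup of $\mathrm{PGL}_{m+1}(\mathbb{C})$ is admissible if it is contained in $\mathrm{Aut}(T)$ for some set $T$ of $n\ge m+3$ distinct points of $\mathbb{P}^m(\mathbb{C})$ in general position. It is a known fact that a subgroup of prime order $p\ge m+1$ in $\mathrm{PGL}_{m+1}(\mathbb{C})$ in diagonal form (i.e. generated by the class of a diagonal matrix of order $p$, with entries powers of a primitive $p$-th root of unity) is admissible if and only if the diagonal entries of this matrix are pairwise distinct. Associated subgroups. Fix a primitive $p$-th root of unity $\epsilon_p$. Let $H\subset\mathrm{PGL}_a(\mathbb{C})$ be an admissible subgroup of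 order $p$ in diagonal form, generated by the class of $\mathrm{diag}(\epsilon_p^{h_1},\ldots,\epsilon_p^{h_a})$ with $h_1,\ldots,h_a\in\mathbb{Z}/p$ pairwise distinct. A subgroup $K\subset\mathrm{PGL}_{p-a}(\mathbb{C})$ is associated to $H$ if it is generated by the class of $\mathrm{diag}(\epsilon_p^{k_1},\ldots,\epsilon_p^{k_{p-a}})$, where $k_1,\ldots,k_{p-a}$ are the elements, in any order, of the complement $(\mathbb{Z}/p)\setminus\{h_1,\ldots,h_a\}$. Associated point sets. For an ordered set $A=(P_1,\ldots,P_n)$ of points in $\mathbb{P}^m(\mathbb{C})$, a coordinate matrix $M_A$ is an $(m+1)\times n$ matrix whose $i$-th column is a vector of projective coordinates of $P_i$. Two ordered sets of $n$ points in general position, $A$ in $\mathbb{P}^m(\mathbb{C})$ and $B$ in $\mathbb{P}^{n-m-2}(\mathbb{C})$, are associated if $M_A\cdot\Lambda\cdot {}^tM_B=0$ for some diagonal matrix $\Lambda=\mathrm{diag}(\delta_1,\ldots,\delta_n)$ with all $\delta_i\ne 0$. Unordered $n$-point sets in general position, $T$ in $\mathbb{P}^m(\mathbb{C})$ and $V$ in $\mathbb{P}^{n-m-2}(\mathbb{C})$, are associated if there exist orderings of $T$ and of $V$ such that the corresponding ordered sets are associated. Here $n=p$ and $m=a-1$, so $n-m-2=p-a-1$. *)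

theory Defs
  imports
    "HOL-Algebra.Multiplicative_Group"
    "HOL-Algebra.Generated_Groups"
    "HOL-Algebra.Group_Action"
    "HOL-Computational_Algebra.Primes"
    "Jordan_Normal_Form.DL_Rank"
begin

section \<open>Complex projective space\<close>

text \<open>A point of $P^m$ is the set of all its coordinate vectors, i.e. a line through the origin of
  the space of complex vectors of length m + 1 with the origin removed.\<close>

definition proj_point :: "complex vec \<Rightarrow> complex vec set" where
  "proj_point v = {c \<cdot>\<^sub>v v | c. c \<noteq> 0}"

definition proj_space :: "nat \<Rightarrow> complex vec set set" where
  "proj_space m = proj_point ` (carrier_vec (m + 1) - {0\<^sub>v (m + 1)})"

definition identity_point :: "nat \<Rightarrow> complex vec set" where
  "identity_point m = proj_point (vec (m + 1) (\<lambda>_. 1))"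

definition (in vec_space) span_dim :: "'a vec set \<Rightarrow> nat" where
  "span_dim S = vectorspace.dim class_ring (span_vs S)"

text \<open>The projective subspace spanned by a set S of points is the projectivization of the linear
  span of all their coordinate vectors; it has projective dimension t - 1 iff that linear span has
  dimension t.\<close>

definition general_position :: "nat \<Rightarrow> complex vec set set \<Rightarrow> bool" where
  "general_position m T \<longleftrightarrow>
     (\<forall>S \<subseteq> T. finite S \<and> card S \<le> m + 1 \<longrightarrow>
        vec_space.span_dim (m + 1) (\<Union>S) = card S)"


section \<open>The projective linear group\<close>

definition GL :: "nat \<Rightarrow> complex mat monoid" where
  "GL n = units_of (ring_mat TYPE(complex) n ())"

definition scalar_mats :: "nat \<Rightarrow> complex mat set" where
  "scalar_mats n = {c \<cdot>\<^sub>m 1\<^sub>m n | c. c \<noteq> 0}"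

definition PGL :: "nat \<Rightarrow> complex mat set monoid" where
  "PGL n = GL n Mod scalar_mats n"

definition PGL_class :: "nat \<Rightarrow> complex mat \<Rightarrow> complex mat set" where
  "PGL_class n A = scalar_mats n #>\<^bsub>GL n\<^esub> A"

definition proj_act :: "complex mat set \<Rightarrow> complex vec set \<Rightarrow> complex vec set" where
  "proj_act f P = {A *\<^sub>v v | A v. A \<in> f \<and> v \<in> P}"

definition Aut_points :: "nat \<Rightarrow> complex vec set set \<Rightarrow> complex mat set set" where
  "Aut_points m T = {f \<in> carrier (PGL (m + 1)). proj_act f ` T = T}"

definition admissible :: "nat \<Rightarrow> complex mat set set \<Rightarrow> bool" where
  "admissible m H \<longleftrightarrow> subgroup H (PGL (m + 1)) \<and> finite H \<and>
     (\<exists>T \<subseteq> proj_space m. finite T \<and> card T \<ge> m + 3 \<and> general_position m T \<and>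
        H \<subseteq> Aut_points m T)"


section \<open>Diagonal form and associated subgroups\<close>

definition primitive_root_of_unity :: "nat \<Rightarrow> complex \<Rightarrow> bool" where
  "primitive_root_of_unity n z \<longleftrightarrow> n > 0 \<and> z ^ n = 1 \<and> (\<forall>k. 0 < k \<and> k < n \<longrightarrow> z ^ k \<noteq> 1)"

definition diagonal_form :: "nat \<Rightarrow> nat \<Rightarrow> complex mat set set \<Rightarrow> bool" where
  "diagonal_form p n H \<longleftrightarrow>
     (\<exists>\<zeta> h. primitive_root_of_unity p \<zeta> \<and>
        group.ord (GL n) (mat_diag n (\<lambda>i. \<zeta> ^ h i)) = p \<and>
        H = generate (PGL n) {PGL_class n (mat_diag n (\<lambda>i. \<zeta> ^ h i))})"

text \<open>Exponents in $Z/p$ are represented by their residues in \<open>{..<p}\<close>.  The function \<open>k\<close> lists the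
  complement of the exponents of \<open>H\<close> in arbitrary order.\<close>

definition associated_subgroup ::
  "nat \<Rightarrow> complex \<Rightarrow> nat \<Rightarrow> complex mat set set \<Rightarrow> complex mat set set \<Rightarrow> bool" where
  "associated_subgroup p \<epsilon> a H K \<longleftrightarrow>
     (\<exists>h k. inj_on h {..<a} \<and> h ` {..<a} \<subseteq> {..<p} \<and>
        bij_betw k {..<p - a} ({..<p} - h ` {..<a}) \<and>
        H = generate (PGL a) {PGL_class a (mat_diag a (\<lambda>i. \<epsilon> ^ h i))} \<and>
        K = generate (PGL (p - a)) {PGL_class (p - a) (mat_diag (p - a) (\<lambda>j. \<epsilon> ^ k j))})"


section \<open>Associated point sets\<close>

definition coordinate_matrix :: "nat \<Rightarrow> complex vec set list \<Rightarrow> complex mat \<Rightarrow> bool" where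
  "coordinate_matrix m A M \<longleftrightarrow>
     M \<in> carrier_mat (m + 1) (length A) \<and> (\<forall>i < length A. col M i \<in> A ! i)"

text \<open>The bound \<open>m + 2 \<le> n\<close> makes \<open>n - m - 2\<close> a genuine difference.\<close>

definition associated_ordered ::
  "nat \<Rightarrow> nat \<Rightarrow> complex vec set list \<Rightarrow> complex vec set list \<Rightarrow> bool" where
  "associated_ordered n m A B \<longleftrightarrow> m + 2 \<le> n \<and>
     length A = n \<and> distinct A \<and> set A \<subseteq> proj_space m \<and> general_position m (set A) \<and>
     length B = n \<and> distinct B \<and> set B \<subseteq> proj_space (n - m - 2) \<and>
       general_position (n - m - 2) (set B) \<and>
     (\<exists>M N \<delta>. coordinate_matrix m A M \<and> coordinate_matrix (n - m - 2) B N \<and>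
        (\<forall>i < n. \<delta> i \<noteq> 0) \<and>
        M * mat_diag n \<delta> * transpose_mat N = 0\<^sub>m (m + 1) (n - m - 2 + 1))"

definition associated_point_sets ::
  "nat \<Rightarrow> nat \<Rightarrow> complex vec set set \<Rightarrow> complex vec set set \<Rightarrow> bool" where
  "associated_point_sets n m T V \<longleftrightarrow>
     (\<exists>A B. set A = T \<and> set B = V \<and> associated_ordered n m A B)"

end

theory Submission
  imports Defs "Jordan_Normal_Form.Char_Poly"
begin

text \<open>
Write \<open>h\<close> for the exponents of \<open>H\<close> and \<open>k\<close> for those of \<open>K\<close>.  Powers of the diagonal generators
move the identity point to the points with coordinates \<open>\<epsilon> ^ (i * h r)\<close>, respectively
\<open>\<epsilon> ^ (i * k s)\<close>, so \<open>T\<close> and \<open>V\<close> consist of the columns of two complementary row blocks of the Fourier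
matrix of order \<open>p\<close>.

The association itself is the orthogonality of characters.  Replacing \<open>i\<close> by \<open>-i\<close> only reorders the
points of \<open>V\<close>; after this reordering the entry of \<open>M * transpose_mat N\<close> at \<open>(r, s)\<close> is the sum over
\<open>i\<close> of the powers of \<open>\<epsilon> ^ (h r - k s)\<close>.  It vanishes because the exponents of \<open>H\<close> and of \<open>K\<close> are
disjoint.  All weights \<open>\<delta>\<close> can therefore be taken to be 1 (lemma \<open>associated_fourier_points\<close>).

The substance lies in general position: any \<open>t\<close> columns must remain independent on any \<open>t\<close> of the
chosen rows.  This is Chebotarev's theorem that all minors of the Fourier matrix of prime order are
nonzero (\<open>chebotarev_fourier_minors\<close>).  Newton interpolation factors a generalized Vandermonde
determinant \<open>det (z i ^ h j)\<close> as the product of the differences \<open>z i - z l\<close> and a determinant \<open>Q\<close> whose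
entries are complete homogeneous symmetric polynomials in the \<open>z i\<close> (\<open>det_generalized_vandermonde\<close>).
With \<open>z i = X ^ x i\<close>, \<open>Q\<close> is an integer polynomial in one variable.  If the minor vanished, then
\<open>Q\<close> would have the root \<open>\<zeta>\<close>, and \<open>p\<close> would divide \<open>Q(1)\<close> (\<open>prime_dvd_poly_at_one\<close>).  But \<open>Q(1)\<close> is a
determinant of binomial coefficients, which divides the Vandermonde product of the \<open>h j\<close>
(\<open>det_binomial\<close>), and no factor of that product is divisible by \<open>p\<close>.
\<close>

section \<open>Newton interpolation and generalized Vandermonde determinants\<close>

text \<open>The complete homogeneous symmetric polynomial of degree \<open>h - k\<close> in \<open>z 0, ..., z k\<close>, which is also
the divided difference of \<open>X ^ h\<close> at these nodes.  The recursion is the one that makes the Newton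
expansion of \<open>X ^ h\<close> provable by induction on \<open>h\<close>, and at \<open>z = 1\<close> it is Pascal's rule.\<close>

fun complete_sym :: "(nat \<Rightarrow> 'a::comm_ring_1) \<Rightarrow> nat \<Rightarrow> nat \<Rightarrow> 'a" where
  "complete_sym z 0 k = (if k = 0 then 1 else 0)"
| "complete_sym z (Suc h) 0 = z 0 * complete_sym z h 0"
| "complete_sym z (Suc h) (Suc k) = z (Suc k) * complete_sym z h (Suc k) + complete_sym z h k"

lemma (in comm_ring_hom) hom_complete_sym: "hom (complete_sym z h k) = complete_sym (\<lambda>i. hom (z i)) h k"
  by (induction z h k rule: complete_sym.induct) (auto simp: hom_distribs)

lemma complete_sym_one: "complete_sym (\<lambda>i. 1) h k = of_nat (h choose k)"
proof (induction h arbitrary: k)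
  case 0
  then show ?case by (cases k) auto
next
  case (Suc h)
  then show ?case by (cases k) (auto simp: algebra_simps)
qed

lemma complete_sym_eq_0: "h < k \<Longrightarrow> complete_sym z h k = 0"
  by (induction z h k rule: complete_sym.induct) auto

lemma complete_sym_diag: "complete_sym z k k = 1"
  by (induction k) (auto simp: complete_sym_eq_0)

text \<open>Multiplying the expansion of \<open>x ^ h\<close> by \<open>x = z k + (x - z k)\<close> in its \<open>k\<close>-th term
yields the recursion of \<open>complete_sym\<close>.\<close>

lemma newton_expansion:
  fixes x :: "'a::comm_ring_1"
  assumes "h \<le> m"
  shows "x ^ h = (\<Sum>k\<le>m. complete_sym z h k * (\<Prod>l<k. x - z l))"
  using assms
proof (induction h)
  case 0
  have "(\<Sum>k\<le>m. complete_sym z 0 k * (\<Prod>l<k. x - z l)) = (\<Sum>k\<le>m. if k = 0 then 1 else 0)"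
    by (intro sum.cong) auto
  then show ?case by simp
next
  case (Suc h)
  let ?N = "\<lambda>k. \<Prod>l<k. x - z l"
  obtain m' where m: "m = Suc m'" "complete_sym z h m = 0"
    using Suc.prems complete_sym_eq_0[of h m z] by (cases m) auto
  have "x ^ Suc h = (\<Sum>k\<le>m. x * (complete_sym z h k * ?N k))"
    using Suc by (simp add: sum_distrib_left)
  also have "\<dots> = (\<Sum>k\<le>m. z k * complete_sym z h k * ?N k + complete_sym z h k * ?N (Suc k))"
    by (intro sum.cong) (auto simp: algebra_simps)
  also have "\<dots> = (\<Sum>k\<le>m. z k * complete_sym z h k * ?N k) + (\<Sum>k\<le>m'. complete_sym z h k * ?N (Suc k))"
    using m by (simp add: sum.distrib)
  also have "(\<Sum>k\<le>m. z k * complete_sym z h k * ?N k) =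
      z 0 * complete_sym z h 0 + (\<Sum>k\<le>m'. z (Suc k) * complete_sym z h (Suc k) * ?N (Suc k))"
    unfolding m by (subst sum.atMost_Suc_shift) simp
  finally have "x ^ Suc h = z 0 * complete_sym z h 0 + (\<Sum>k\<le>m'. complete_sym z (Suc h) (Suc k) * ?N (Suc k))"
    by (simp add: sum.distrib algebra_simps del: prod.lessThan_Suc)
  then show ?case
    unfolding m by (subst sum.atMost_Suc_shift) simp
qed

text \<open>At a node the Newton products from index \<open>n\<close> on vanish, so the expansion has at most \<open>n\<close>
terms whatever the exponent; this is what makes the factorization below one of square matrices.\<close>

lemma newton_expansion_at_node:
  fixes z :: "nat \<Rightarrow> 'a::comm_ring_1"
  assumes "i < n"
  shows "z i ^ h = (\<Sum>k<n. complete_sym z h k * (\<Prod>l<k. z i - z l))"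
proof -
  have "z i ^ h = (\<Sum>k\<le>n + h. complete_sym z h k * (\<Prod>l<k. z i - z l))"
    by (intro newton_expansion) simp
  also have "\<dots> = (\<Sum>k<n. complete_sym z h k * (\<Prod>l<k. z i - z l))"
  proof (intro sum.mono_neutral_right ballI)
    fix k assume "k \<in> {..n + h} - {..<n}"
    then have "(\<Prod>l<k. z i - z l) = 0"
      using assms by (intro prod_zero bexI[of _ i]) auto
    then show "complete_sym z h k * (\<Prod>l<k. z i - z l) = 0" by simp
  qed auto
  finally show ?thesis .
qed

text \<open>The Newton expansion at the nodes is a matrix factorization whose left factor is lower
triangular.\<close>

lemma det_generalized_vandermonde:
  fixes z :: "nat \<Rightarrow> 'a::comm_ring_1"
  shows "det (mat n n (\<lambda>(i,j). z i ^ h j)) =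
    (\<Prod>i<n. \<Prod>l<i. z i - z l) * det (mat n n (\<lambda>(k,j). complete_sym z (h j) k))"
proof -
  let ?N = "mat n n (\<lambda>(i,k). \<Prod>l<k. z i - z l)" and ?C = "mat n n (\<lambda>(k,j). complete_sym z (h j) k)"
  have "mat n n (\<lambda>(i,j). z i ^ h j) = ?N * ?C"
  proof (rule eq_matI)
    fix i j assume "i < dim_row (?N * ?C)" "j < dim_col (?N * ?C)"
    then have ij: "i < n" "j < n" by auto
    then have "z i ^ h j = (\<Sum>k<n. complete_sym z (h j) k * (\<Prod>l<k. z i - z l))"
      by (intro newton_expansion_at_node)
    then show "mat n n (\<lambda>(i,j). z i ^ h j) $$ (i,j) = (?N * ?C) $$ (i,j)"
      using ij by (simp add: scalar_prod_def atLeast0LessThan mult.commute)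
  qed auto
  moreover have "det ?N = (\<Prod>i<n. \<Prod>l<i. z i - z l)"
    by (subst det_lower_triangular[of n])
       (auto simp: prod_list_diag_prod atLeast0LessThan intro!: prod_zero)
  ultimately show ?thesis by (simp add: det_mult[of _ n])
qed

text \<open>Up to row factors \<open>fact k\<close>, the binomial coefficients are the falling factorials of the
\<open>h j\<close>.  These are the Newton products at the nodes \<open>0, 1, 2, ...\<close>, so they differ from the plain powers
by a unitriangular change of basis.\<close>

lemma det_binomial:
  fixes h :: "nat \<Rightarrow> nat"
  shows "det (mat n n (\<lambda>(k,j). of_nat (h j choose k))) * (\<Prod>k<n. fact k) =
    (\<Prod>i<n. \<Prod>l<i. (of_nat (h i) - of_nat (h l) :: int))"
proof -
  let ?B = "mat n n (\<lambda>(k,j). of_nat (h j choose k)) :: int mat"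
  let ?x = "\<lambda>i. int (h i)" and ?D = "mat_diag n (\<lambda>k. fact k :: int)"
  let ?U = "mat n n (\<lambda>(k,j). complete_sym int j k)" and ?V = "mat n n (\<lambda>(k,j). complete_sym ?x j k)"
  \<comment> \<open>The change of basis between monomials and Newton products is unitriangular for any nodes.\<close>
  have U: "det (mat n n (\<lambda>(k,j). complete_sym z j k)) = 1" for z :: "nat \<Rightarrow> int"
    by (subst det_upper_triangular[of _ n])
       (auto simp: prod_list_diag_prod complete_sym_eq_0 complete_sym_diag intro!: upper_triangularI)
  have ff: "fact k * int (m choose k) = (\<Prod>l<k. int m - int l)" for m k
  proof (cases "k \<le> m")
    case True
    have "real_of_int (fact k * int (m choose k)) = real_of_int (\<Prod>l<k. int m - int l)"
      by (simp add: binomial_gbinomial gbinomial_prod_rev atLeast0LessThan)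
    then show ?thesis by (metis of_int_eq_iff)
  next
    case False
    then have "(\<Prod>l<k. int m - int l) = 0" by (intro prod_zero) auto
    then show ?thesis using False by (simp add: binomial_eq_0)
  qed
  have "mat n n (\<lambda>(i,j). ?x i ^ j) = transpose_mat (?D * ?B) * ?U" (is "?L = ?R")
  proof (rule eq_matI)
    fix i j assume "i < dim_row ?R" "j < dim_col ?R"
    then have ij: "i < n" "j < n" by auto
    then have "?x i ^ j = (\<Sum>k<n. complete_sym int j k * (\<Prod>l<k. ?x i - int l))"
      using newton_expansion[of j "n - 1" "?x i" int] by (cases n) (auto simp: lessThan_Suc_atMost)
    then show "?L $$ (i,j) = ?R $$ (i,j)"
      using ij by (simp add: scalar_prod_def atLeast0LessThan mult.commute mat_diag_mult_left[of _ n n] ff[symmetric])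
  qed auto
  moreover have DB: "?D * ?B \<in> carrier_mat n n" by (intro mult_carrier_mat[of _ _ n]) auto
  ultimately have "det ?L = det (transpose_mat (?D * ?B)) * det ?U"
    by (simp only: det_mult[of "transpose_mat (?D * ?B)" n ?U] transpose_carrier_mat mat_carrier)
  also have "\<dots> = det (?D * ?B)"
    by (subst det_transpose[OF DB]) (simp add: U)
  also have "\<dots> = det ?D * det ?B" by (simp add: det_mult[of _ n])
  also have "det ?D = (\<Prod>k<n. fact k)"
    by (subst det_lower_triangular[of n])
       (auto simp: prod_list_diag_prod atLeast0LessThan mat_diag_def)
  finally show ?thesis
    using det_generalized_vandermonde[of n ?x "\<lambda>j. j"] by (simp add: U mult.commute)
qed

section \<open>Integer polynomials at roots of unity of prime order\<close>

text \<open>Multiplication by \<open>r(\<zeta>)\<close> maps each of the powers \<open>1, \<zeta>, ..., \<zeta> ^ (p - 1)\<close> to an integer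
combination of them.  Hence \<open>r(\<zeta>)\<close> is an eigenvalue of an integer circulant matrix and a root of its monic
characteristic polynomial.\<close>

lemma algebraic_int_poly_root_of_unity:
  fixes \<zeta> :: complex
  assumes "p > 0" "\<zeta> ^ p = 1"
  shows "algebraic_int (poly (map_poly of_int r) \<zeta>)"
proof -
  define q where "q = map_poly complex_of_int r"
  \<comment> \<open>Row \<open>i\<close> expands \<open>r(\<zeta>) * \<zeta> ^ i\<close> in powers of \<open>\<zeta>\<close> with exponents reduced modulo \<open>p\<close>.\<close>
  define c where "c i j = (\<Sum>k \<in> {k. k \<le> degree q \<and> (k + i) mod p = j}. coeff r k)" for i j
  define A where "A = mat p p (\<lambda>(i,j). c i j)"
  define v where "v = vec p (\<lambda>i. \<zeta> ^ i)"
  have zmod: "\<zeta> ^ (m mod p) = \<zeta> ^ m" for m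
    by (metis assms(2) div_mult_mod_eq mult.left_neutral power_add power_mult power_one mult.commute)
  have A: "map_mat complex_of_int A \<in> carrier_mat p p" "A \<in> carrier_mat p p" by (auto simp: A_def)
  have "eigenvector (map_mat of_int A) v (poly q \<zeta>)"
    unfolding eigenvector_def
  proof (intro conjI)
    show "v \<in> carrier_vec (dim_row (map_mat of_int A))" by (simp add: A_def v_def)
    show "v \<noteq> 0\<^sub>v (dim_row (map_mat of_int A))"
      using assms(1) by (auto simp: A_def v_def vec_eq_iff intro!: exI[of _ 0])
    show "map_mat of_int A *\<^sub>v v = poly q \<zeta> \<cdot>\<^sub>v v"
    proof (rule eq_vecI)
      fix i assume "i < dim_vec (poly q \<zeta> \<cdot>\<^sub>v v)"
      then have i: "i < p" by (simp add: v_def)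
      have "(map_mat of_int A *\<^sub>v v) $ i = (\<Sum>j<p. of_int (c i j) * \<zeta> ^ j)"
        using i by (simp add: A_def v_def scalar_prod_def atLeast0LessThan)
      also have "\<dots> = (\<Sum>j<p. \<Sum>k \<in> {k. k \<in> {..degree q} \<and> (k + i) mod p = j}. coeff q k * \<zeta> ^ (k + i))"
        unfolding c_def of_int_sum sum_distrib_right
        by (intro sum.cong) (auto simp: q_def zmod coeff_map_poly)
      also have "\<dots> = (\<Sum>k\<le>degree q. coeff q k * \<zeta> ^ (k + i))"
        using assms(1) by (intro sum.group) auto
      also have "\<dots> = poly q \<zeta> * \<zeta> ^ i"
        by (simp add: poly_altdef sum_distrib_right power_add mult.assoc)
      finally show "(map_mat of_int A *\<^sub>v v) $ i = (poly q \<zeta> \<cdot>\<^sub>v v) $ i" using i by (simp add: v_def)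
    qed (auto simp: A_def v_def)
  qed
  then have "poly (char_poly (map_mat of_int A)) (poly q \<zeta>) = 0"
    using eigenvalue_root_char_poly[OF A(1)] by (auto simp: eigenvalue_def)
  then have "poly (map_poly of_int (char_poly A)) (poly q \<zeta>) = 0"
    unfolding of_int_hom.char_poly_hom[OF A(2)] .
  moreover have "lead_coeff (char_poly A) = 1" using degree_monic_char_poly[OF A(2)] by auto
  ultimately show ?thesis unfolding algebraic_int_altdef_ipoly q_def by blast
qed

lemma binomial_prime_power:
  fixes a b :: "'a::comm_ring_1"
  assumes "prime p"
  shows "(a + b) ^ p = a ^ p + b ^ p + of_nat p * (\<Sum>k\<in>{0<..<p}. of_nat ((p choose k) div p) * a ^ k * b ^ (p - k))"
proof -
  have p: "p > 0" using assms prime_gt_0_nat by blast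
  have "{..p} = insert 0 (insert p {0<..<p})" using p by auto
  then have "(a + b) ^ p = a ^ p + b ^ p + (\<Sum>k\<in>{0<..<p}. of_nat (p choose k) * a ^ k * b ^ (p - k))"
    using p by (simp add: binomial_ring)
  also have "(\<Sum>k\<in>{0<..<p}. of_nat (p choose k) * a ^ k * b ^ (p - k)) =
      of_nat p * (\<Sum>k\<in>{0<..<p}. of_nat ((p choose k) div p) * a ^ k * b ^ (p - k))"
    unfolding sum_distrib_left
  proof (intro sum.cong refl)
    fix k assume "k \<in> {0<..<p}"
    then have "p dvd (p choose k)" using dvd_choose_prime[of k p] assms by auto
    then have "(of_nat (p choose k) :: 'a) = of_nat p * of_nat ((p choose k) div p)"
      by (metis dvd_mult_div_cancel of_nat_mult)
    then show "of_nat (p choose k) * a ^ k * b ^ (p - k) =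
      of_nat p * (of_nat ((p choose k) div p) * a ^ k * b ^ (p - k))" by (simp add: mult.assoc)
  qed
  finally show ?thesis .
qed

lemma prime_dvd_power_minus_self:
  fixes a :: int
  assumes "prime (p::nat)"
  shows "int p dvd a ^ p - a"
proof -
  have nat: "int p dvd int n ^ p - int n" for n
  proof (induction n)
    case 0
    then show ?case using assms prime_gt_0_nat[of p] by (simp add: power_0_left)
  next
    case (Suc n)
    obtain c where "(int n + 1) ^ p = int n ^ p + 1 ^ p + int p * c"
      using binomial_prime_power[OF assms, of "int n" 1] by auto
    then have "int (Suc n) ^ p - int (Suc n) = (int n ^ p - int n) + int p * c"
      by (simp add: algebra_simps)
    then show ?case using Suc by (simp only: dvd_add dvd_triv_left)
  qed
  \<comment> \<open>Negative integers reduce to their residues, to which the induction over the naturals applies.\<close>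
  have "(a mod int p) ^ p mod int p = a mod int p"
    using nat[of "nat (a mod int p)"] assms prime_gt_0_nat[of p]
    by (simp add: mod_eq_dvd_iff[symmetric])
  then show ?thesis by (simp add: power_mod mod_eq_dvd_iff)
qed


text \<open>The Frobenius congruence \<open>q(X) ^ p = q(X ^ p)\<close> modulo \<open>p\<close>, evaluated at a \<open>p\<close>-th root of unity.\<close>

lemma poly_power_prime_at_root_of_unity:
  fixes \<zeta> :: complex
  assumes "prime p" and "\<zeta> ^ p = 1"
  shows "\<exists>r. poly (map_poly of_int q) \<zeta> ^ p =
    of_int (poly q 1) + of_nat p * poly (map_poly of_int r) \<zeta>"
proof (induction q)
  case 0
  have "p > 0" using assms(1) prime_gt_0_nat by blast
  then show ?case by (intro exI[of _ 0]) simp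
next
  case (pCons a q)
  let ?ev = "\<lambda>q. poly (map_poly complex_of_int q) \<zeta>"
  from pCons.IH obtain r where r: "?ev q ^ p = of_int (poly q 1) + of_nat p * ?ev r" by blast
  \<comment> \<open>The binomial expansion takes place among integer polynomials, so that the multiple of \<open>p\<close> in
    it is again a value of an integer polynomial.\<close>
  obtain c where c: "([:a:] + [:0,1:] * q) ^ p = [:a:] ^ p + ([:0,1:] * q) ^ p + of_nat p * c"
    using binomial_prime_power[OF assms(1), of "[:a:]" "[:0,1:] * q"] by blast
  obtain t where t: "a ^ p - a = int p * t" using prime_dvd_power_minus_self[OF assms(1), of a] by (auto elim: dvdE)
  have "?ev (pCons a q) ^ p = ?ev (([:a:] + [:0,1:] * q) ^ p)"
    by (simp add: hom_distribs)
  also have "\<dots> = of_int a ^ p + \<zeta> ^ p * ?ev q ^ p + of_nat p * ?ev c"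
    unfolding c by (simp add: hom_distribs power_mult_distrib)
  also have "(of_int a :: complex) ^ p = of_int a + of_nat p * of_int t"
    using t by (metis add_diff_cancel_left' diff_add_cancel add.commute of_int_add of_int_mult of_int_of_nat_eq of_int_power)
  finally have "?ev (pCons a q) ^ p =
      of_int (poly (pCons a q) 1) + of_nat p * ?ev (r + c + [:t:])"
    using assms(2) r by (simp add: hom_distribs algebra_simps)
  then show ?case by blast
qed

text \<open>If \<open>q(\<zeta>) = 0\<close>, the Frobenius congruence exhibits \<open>q(1) / p\<close> as the negative of a value
\<open>r(\<zeta>)\<close>.  This is a rational algebraic integer, hence an integer.\<close>

lemma prime_dvd_poly_at_one:
  fixes \<zeta> :: complex
  assumes "prime p" and "\<zeta> ^ p = 1" and "poly (map_poly of_int q) \<zeta> = 0"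
  shows "int p dvd poly q 1"
proof -
  have p: "p > 0" using assms(1) prime_gt_0_nat by blast
  obtain r where r: "poly (map_poly of_int q) \<zeta> ^ p =
      of_int (poly q 1) + of_nat p * poly (map_poly of_int r) \<zeta>"
    using poly_power_prime_at_root_of_unity[OF assms(1,2)] by blast
  then have eq: "of_int (poly q 1) = of_nat p * - poly (map_poly of_int r) \<zeta>"
    using assms(3) p by (simp add: eq_neg_iff_add_eq_0 power_0_left)
  then have "poly (map_poly of_int r) \<zeta> = - of_int (poly q 1) / of_nat p"
    using p by (simp add: field_simps)
  then have "poly (map_poly of_int r) \<zeta> \<in> \<rat>" by simp
  then have "poly (map_poly of_int r) \<zeta> \<in> \<int>"
    using rational_algebraic_int_is_int algebraic_int_poly_root_of_unity[OF p assms(2)] by blast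
  then obtain t where "poly (map_poly of_int r) \<zeta> = of_int t" by (elim Ints_cases)
  with eq have "complex_of_int (poly q 1) = of_int (int p * - t)" by simp
  then have "poly q 1 = int p * - t" by (simp only: of_int_eq_iff)
  then show ?thesis by simp
qed

section \<open>Minors of the Fourier matrix of prime order\<close>

lemma primitive_root_power_inj:
  assumes "primitive_root_of_unity p \<zeta>"
  shows "inj_on (\<lambda>i. \<zeta> ^ i) {..<p}"
proof (rule linorder_inj_onI')
  have nz: "\<zeta> \<noteq> 0" using assms by (auto simp: primitive_root_of_unity_def power_0_left)
  fix i j assume ij: "i \<in> {..<p}" "j \<in> {..<p}" "i < j"
  show "\<zeta> ^ i \<noteq> \<zeta> ^ j"
  proof
    assume "\<zeta> ^ i = \<zeta> ^ j"
    then have "\<zeta> ^ (j - i) = 1"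
      using ij nz by (simp add: power_diff)
    then show False using assms ij unfolding primitive_root_of_unity_def
      by (metis diff_less_mono2 diff_is_0_eq leD le_less_trans lessThan_iff less_imp_diff_less zero_less_diff)
  qed
qed

text \<open>Chebotarev's theorem.  The cofactor \<open>Q\<close> of the Vandermonde product is formed over the integer
polynomials, so that it can be evaluated both at \<open>\<zeta>\<close>, where it would have to vanish with the minor,
and at 1, where it is prime to \<open>p\<close>.\<close>

theorem chebotarev_fourier_minors:
  assumes "prime p" and \<zeta>: "primitive_root_of_unity p \<zeta>"
    and x: "inj_on x {..<n}" "x ` {..<n} \<subseteq> {..<p}"
    and h: "inj_on h {..<n}" "h ` {..<n} \<subseteq> {..<p}"
  shows "det (mat n n (\<lambda>(i,j). \<zeta> ^ (x i * h j))) \<noteq> 0"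
proof
  define C :: "int poly mat" where "C = mat n n (\<lambda>(k,j). complete_sym (\<lambda>i. monom 1 (x i)) (h j) k)"
  interpret ev: comm_ring_hom "\<lambda>q. poly (map_poly complex_of_int q) \<zeta>"
    by unfold_locales (auto simp: hom_distribs)
  have ev1_hom: "comm_ring_hom (\<lambda>q :: int poly. poly q 1)"
    by unfold_locales auto
  \<comment> \<open>Determinants and complete symmetric polynomials commute with both evaluations.\<close>
  have ev: "poly (map_poly of_int (det C)) \<zeta> = det (mat n n (\<lambda>(k,j). complete_sym (\<lambda>i. \<zeta> ^ x i) (h j) k))"
    unfolding ev.hom_det[symmetric] C_def
    by (intro arg_cong[of _ _ det] eq_matI) (auto simp: ev.hom_complete_sym poly_monom)
  have ev1: "poly (det C) 1 = det (mat n n (\<lambda>(k,j). of_nat (h j choose k)))"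
    unfolding comm_ring_hom.hom_det[OF ev1_hom, symmetric] C_def
    by (intro arg_cong[of _ _ det] eq_matI) (auto simp: comm_ring_hom.hom_complete_sym[OF ev1_hom] poly_monom complete_sym_one)
  assume "det (mat n n (\<lambda>(i,j). \<zeta> ^ (x i * h j))) = 0"
  then have "(\<Prod>i<n. \<Prod>l<i. \<zeta> ^ x i - \<zeta> ^ x l) * poly (map_poly of_int (det C)) \<zeta> = 0"
    unfolding ev det_generalized_vandermonde[symmetric] by (simp add: power_mult)
  moreover have "\<zeta> ^ x i \<noteq> \<zeta> ^ x l" if "i < n" "l < i" for i l
  proof
    assume "\<zeta> ^ x i = \<zeta> ^ x l"
    then have "x i = x l"
      using that x(2) by (intro inj_onD[OF primitive_root_power_inj[OF \<zeta>]]) (auto simp: image_subset_iff)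
    then show False using that inj_onD[OF x(1), of i l] by auto
  qed
  ultimately have "poly (map_poly of_int (det C)) \<zeta> = 0" by auto
  then have "int p dvd poly (det C) 1"
    using prime_dvd_poly_at_one assms(1) \<zeta> by (auto simp: primitive_root_of_unity_def)
  then have "int p dvd (\<Prod>i<n. \<Prod>l<i. int (h i) - int (h l))"
    unfolding ev1 det_binomial[symmetric] by (rule dvd_mult2)
  then obtain i l where il: "i < n" "l < i" "int p dvd int (h i) - int (h l)"
    using assms(1) by (auto simp: prime_dvd_prod_iff)
  moreover have "h i < p" "h l < p" using il h(2) by (auto simp: image_subset_iff)
  moreover have "h i \<noteq> h l" using il inj_onD[OF h(1), of i l] by auto
  ultimately show False using dvd_imp_le_int[of "int (h i) - int (h l)" "int p"] by auto
qed

lemma fourier_columns_independent: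
  fixes \<zeta> :: complex and n :: nat
  assumes "prime p" and \<zeta>: "primitive_root_of_unity p \<zeta>"
    and x: "inj_on x {..<n}" "x ` {..<n} \<subseteq> {..<p}"
    and h: "inj_on h {..<n}" "h ` {..<n} \<subseteq> {..<p}"
    and rel: "\<And>r. r < n \<Longrightarrow> (\<Sum>c<n. \<zeta> ^ (x c * h r) * v c) = 0"
    and c: "c < n"
  shows "v c = 0"
proof -
  let ?F = "mat n n (\<lambda>(r,c). \<zeta> ^ (h r * x c))"
  have "?F *\<^sub>v vec n v = 0\<^sub>v n"
    using rel by (intro eq_vecI) (auto simp: scalar_prod_def atLeast0LessThan mult.commute)
  moreover have "det ?F \<noteq> 0" by (rule chebotarev_fourier_minors[OF assms(1) \<zeta> h x])
  ultimately have "vec n v = 0\<^sub>v n"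
    using det_0_iff_vec_prod_zero[of ?F n] by (metis mat_carrier vec_carrier)
  then show ?thesis using c by (metis index_vec index_zero_vec(1))
qed

section \<open>General position of columns of the Fourier matrix\<close>

text \<open>The image of the all-ones vector under the \<open>i\<close>-th power of the diagonal matrix with entries
\<open>\<zeta> ^ h j\<close>; equivalently, part of the \<open>i\<close>-th column of the Fourier matrix.\<close>

definition fourier_vec :: "complex \<Rightarrow> nat \<Rightarrow> (nat \<Rightarrow> nat) \<Rightarrow> nat \<Rightarrow> complex vec" where
  "fourier_vec \<zeta> n h i = vec n (\<lambda>j. \<zeta> ^ (i * h j))"

lemma self_in_proj_point: "v \<in> proj_point v"
  unfolding proj_point_def by (rule CollectI) (auto intro!: exI[of _ 1])

text \<open>Two proportional columns would be dependent already in their first two coordinates,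
contradicting the nonvanishing of a minor of size 2.\<close>

lemma fourier_points_inj:
  assumes "prime p" and \<zeta>: "primitive_root_of_unity p \<zeta>" and n: "2 \<le> n"
    and h: "inj_on h {..<n}" "h ` {..<n} \<subseteq> {..<p}"
  shows "inj_on (\<lambda>i. proj_point (fourier_vec \<zeta> n h i)) {..<p}"
proof (rule inj_onI, rule ccontr)
  fix i i' assume i: "i \<in> {..<p}" "i' \<in> {..<p}" "i \<noteq> i'"
    and eq: "proj_point (fourier_vec \<zeta> n h i) = proj_point (fourier_vec \<zeta> n h i')"
  obtain c where "fourier_vec \<zeta> n h i = c \<cdot>\<^sub>v fourier_vec \<zeta> n h i'"
    using self_in_proj_point[of "fourier_vec \<zeta> n h i"] unfolding eq by (auto simp: proj_point_def)
  then have c: "\<zeta> ^ (i * h r) = c * \<zeta> ^ (i' * h r)" if "r < n" for r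
    using that unfolding fourier_vec_def by (metis dim_vec index_smult_vec(1) index_vec)
  \<comment> \<open>The relation \<open>w i - c * w i' = 0\<close> between the two columns, as coefficients indexed by \<open>{..<2}\<close>.\<close>
  let ?x = "\<lambda>k::nat. if k = 0 then i else i'" and ?v = "\<lambda>k::nat. if k = 0 then 1 else - c"
  have two: "{..<2} = {0, 1::nat}" by auto
  have "?v 0 = 0"
  proof (rule fourier_columns_independent[OF assms(1) \<zeta>, of ?x 2 h ?v])
    show "inj_on ?x {..<2}" "?x ` {..<2} \<subseteq> {..<p}" using i by (auto simp: two)
    show "inj_on h {..<2}" "h ` {..<2} \<subseteq> {..<p}"
      using h n by (auto simp: image_subset_iff intro: inj_on_subset)
    show "(\<Sum>k<2. \<zeta> ^ (?x k * h r) * ?v k) = 0" if "r < 2" for r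
      using c[of r] that n by (simp add: two)
  qed auto
  then show False by simp
qed

lemma span_Union_proj_point:
  fixes X :: "complex vec set"
  assumes X: "X \<subseteq> carrier_vec n"
  shows "LinearCombinations.module.span class_ring (module_vec TYPE(complex) n) (\<Union> (proj_point ` X)) =
    LinearCombinations.module.span class_ring (module_vec TYPE(complex) n) X"
proof -
  interpret vec_space "TYPE(complex)" n .
  have sub: "\<Union> (proj_point ` X) \<subseteq> span X"
  proof
    fix w assume "w \<in> \<Union> (proj_point ` X)"
    then obtain v c where "v \<in> X" "w = c \<cdot>\<^sub>v v" by (auto simp: proj_point_def)
    moreover have "v \<in> span X" using in_own_span X \<open>v \<in> X\<close> by auto
    ultimately show "w \<in> span X" using smult_in_span X by simp
  qed
  have "X \<subseteq> \<Union> (proj_point ` X)" using self_in_proj_point by blast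
  then have "span X \<subseteq> span (\<Union> (proj_point ` X))" by (rule span_is_monotone)
  moreover have "span (\<Union> (proj_point ` X)) \<subseteq> span X"
    using sub span_is_submodule[OF X] by (rule span_is_subset)
  ultimately show ?thesis by blast
qed

text \<open>For \<open>t\<close> of the points, the first \<open>t\<close> coordinates alone give a nonzero minor, so the columns are
independent.\<close>

lemma general_position_fourier_points:
  assumes "prime p" and \<zeta>: "primitive_root_of_unity p \<zeta>" and m: "1 \<le> m"
    and h: "inj_on h {..<m + 1}" "h ` {..<m + 1} \<subseteq> {..<p}"
  shows "general_position m ((\<lambda>i. proj_point (fourier_vec \<zeta> (m + 1) h i)) ` {..<p})"
  unfolding general_position_def
proof (intro allI impI)
  let ?w = "fourier_vec \<zeta> (m + 1) h"
  let ?pt = "\<lambda>i. proj_point (?w i)"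
  interpret vec_space "TYPE(complex)" "m + 1" .
  fix S assume S: "S \<subseteq> ?pt ` {..<p}" and fin: "finite S \<and> card S \<le> m + 1"
  define t where "t = card S"
  have inj: "inj_on ?pt {..<p}" using fourier_points_inj[OF assms(1) \<zeta> _ h] m by simp
  obtain I where I: "I \<subseteq> {..<p}" "S = ?pt ` I" using S by (auto simp: subset_image_iff)
  then have "card I = t" unfolding t_def using inj by (metis card_image inj_on_subset)
  moreover have "finite I" using I(1) finite_subset by blast
  ultimately obtain x where x: "bij_betw x {..<t} I"
    using ex_bij_betw_nat_finite[of I] by (auto simp: atLeast0LessThan)
  have xp: "inj_on x {..<t}" "x ` {..<t} \<subseteq> {..<p}" using x I by (auto simp: bij_betw_def)
  define A where "A = mat_of_cols (m + 1) (map (\<lambda>c. ?w (x c)) [0..<t])"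
  have A: "A \<in> carrier_mat (m + 1) t"
    using mat_of_cols_carrier(1)[of "m + 1" "map (\<lambda>c. ?w (x c)) [0..<t]"] by (simp add: A_def)
  have w: "?w i \<in> carrier_vec (m + 1)" for i by (simp add: fourier_vec_def)
  have cols: "cols A = map (\<lambda>c. ?w (x c)) [0..<t]"
    unfolding A_def using w by (intro cols_mat_of_cols) auto
  have "inj_on ?w {..<p}" using inj by (auto simp: inj_on_def)
  then have "inj_on (?w \<circ> x) {..<t}"
    using xp by (intro comp_inj_on) (auto intro: inj_on_subset)
  then have dist: "distinct (cols A)"
    unfolding cols by (simp add: distinct_map atLeast0LessThan comp_def)
  have "lin_indpt (set (cols A))"
  proof
    assume "lin_dep (set (cols A))"
    then obtain v where v: "v \<in> carrier_vec t" "v \<noteq> 0\<^sub>v t" "A *\<^sub>v v = 0\<^sub>v (m + 1)"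
      using lin_depE[OF A _ dist] by blast
    have "v $ c = 0" if "c < t" for c
    proof (rule fourier_columns_independent[OF assms(1) \<zeta> xp, of h "\<lambda>c. v $ c"])
      show "inj_on h {..<t}" "h ` {..<t} \<subseteq> {..<p}"
        using h fin unfolding t_def by (auto simp: image_subset_iff intro: inj_on_subset)
      show "(\<Sum>c<t. \<zeta> ^ (x c * h r) * v $ c) = 0" if "r < t" for r
      proof -
        have r: "r < m + 1" using that fin t_def by simp
        have "(A *\<^sub>v v) $ r = (\<Sum>c<t. \<zeta> ^ (x c * h r) * v $ c)"
          using r v(1) by (simp add: A_def mat_of_cols_def scalar_prod_def fourier_vec_def atLeast0LessThan)
        then show ?thesis using v(3) r by simp
      qed
    qed fact
    then have "v = 0\<^sub>v t" using v(1) by (intro eq_vecI) auto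
    then show False using v(2) by simp
  qed
  then have "rank A = t" by (rule lin_indpt_full_rank[OF A dist])
  moreover have S_cols: "S = proj_point ` set (cols A)"
    using x unfolding cols I(2) bij_betw_def by (auto simp: atLeast0LessThan)
  moreover have "set (cols A) \<subseteq> carrier_vec (m + 1)" using w unfolding cols by auto
  then have "span_dim (\<Union> S) = rank A"
    unfolding span_dim_def rank_def S_cols by (simp only: span_Union_proj_point)
  ultimately show "span_dim (\<Union> S) = card S" by (simp only: t_def)
qed


section \<open>Orbits of diagonal projective transformations\<close>

lemma group_GL: "group (GL n)"
proof -
  interpret ring "ring_mat TYPE(complex) n ()" by (rule ring_mat)
  show ?thesis unfolding GL_def by (rule units_group)
qed

lemma mult_GL [simp]: "monoid.mult (GL n) = (*)"
  by (simp add: GL_def units_of_mult ring_mat_simps)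

lemma one_GL [simp]: "monoid.one (GL n) = 1\<^sub>m n"
  by (simp add: GL_def units_of_one ring_mat_simps)

lemma carrier_GL: "carrier (GL n) = {A \<in> carrier_mat n n. det A \<noteq> 0}"
  unfolding GL_def units_of_carrier
  using unit_imp_det_non_zero[of _ n "()"] det_non_zero_imp_unit[of _ n "()"]
  by (auto simp: Units_def ring_mat_def)

lemma normal_scalar_mats: "scalar_mats n \<lhd> GL n"
proof -
  interpret group "GL n" by (rule group_GL)
  have comm: "c \<cdot>\<^sub>m 1\<^sub>m n * A = A * (c \<cdot>\<^sub>m 1\<^sub>m n)" if "A \<in> carrier_mat n n" for c and A :: "complex mat"
    using that
    by (simp add: mult_smult_assoc_mat[OF one_carrier_mat that] mult_smult_distrib[OF that one_carrier_mat])
  have prod: "c \<cdot>\<^sub>m 1\<^sub>m n * (d \<cdot>\<^sub>m 1\<^sub>m n) = (c * d) \<cdot>\<^sub>m 1\<^sub>m n" for c d :: complex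
    by (subst mult_smult_assoc_mat[of _ n n _ n]) (auto intro!: eq_matI)
  have sub: "scalar_mats n \<subseteq> carrier (GL n)"
    by (auto simp: scalar_mats_def carrier_GL det_smult)
  have "subgroup (scalar_mats n) (GL n)"
  proof (rule subgroupI)
    show "scalar_mats n \<noteq> {}" by (auto simp: scalar_mats_def intro: exI[of _ 1])
  next
    fix A assume "A \<in> scalar_mats n"
    then obtain c where c: "A = c \<cdot>\<^sub>m 1\<^sub>m n" "c \<noteq> 0" by (auto simp: scalar_mats_def)
    have "inv\<^bsub>GL n\<^esub> A = inverse c \<cdot>\<^sub>m 1\<^sub>m n"
      using c sub
      by (intro inv_equality)
         (auto simp: prod carrier_GL det_smult)
    then show "inv\<^bsub>GL n\<^esub> A \<in> scalar_mats n" using c by (auto simp: scalar_mats_def)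
  next
    fix A B assume "A \<in> scalar_mats n" "B \<in> scalar_mats n"
    then obtain c d where "A = c \<cdot>\<^sub>m 1\<^sub>m n" "c \<noteq> 0" "B = d \<cdot>\<^sub>m 1\<^sub>m n" "d \<noteq> 0" by (auto simp: scalar_mats_def)
    then show "A \<otimes>\<^bsub>GL n\<^esub> B \<in> scalar_mats n"
      by (auto simp: scalar_mats_def prod intro!: exI[of _ "c * d"])
  qed (fact sub)
  then show ?thesis
  proof (rule normalI, intro ballI)
    fix A assume "A \<in> carrier (GL n)"
    then show "scalar_mats n #>\<^bsub>GL n\<^esub> A = A <#\<^bsub>GL n\<^esub> scalar_mats n"
      using comm by (auto simp: r_coset_def l_coset_def scalar_mats_def carrier_GL)
  qed
qed

lemma group_PGL: "group (PGL n)"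
  unfolding PGL_def by (rule normal.factorgroup_is_group[OF normal_scalar_mats])

lemma mat_diag_pow_GL:
  "mat_diag n d [^]\<^bsub>GL n\<^esub> (i::nat) = mat_diag n (\<lambda>j. d j ^ i)"
  by (induction i) (auto simp: nat_pow_def mult.commute)

lemma proj_act_PGL_class:
  assumes A: "A \<in> carrier_mat n n" and v: "v \<in> carrier_vec n"
  shows "proj_act (PGL_class n A) (proj_point v) = proj_point (A *\<^sub>v v)"
proof -
  have cls: "PGL_class n A = {c \<cdot>\<^sub>m A | c. c \<noteq> 0}"
    using A by (auto simp: PGL_class_def r_coset_def scalar_mats_def mult_smult_assoc_mat[of _ n n])
  have eq: "(c \<cdot>\<^sub>m A) *\<^sub>v (d \<cdot>\<^sub>v v) = (c * d) \<cdot>\<^sub>v (A *\<^sub>v v)" for c d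
    using A v by (intro eq_vecI) (auto simp: scalar_prod_def sum_distrib_left mult_ac)
  show ?thesis
  proof (intro equalityI subsetI)
    fix w assume "w \<in> proj_act (PGL_class n A) (proj_point v)"
    then show "w \<in> proj_point (A *\<^sub>v v)"
      by (auto simp: proj_act_def proj_point_def cls eq)
  next
    fix w assume "w \<in> proj_point (A *\<^sub>v v)"
    then obtain c where "w = c \<cdot>\<^sub>v (A *\<^sub>v v)" "c \<noteq> 0" by (auto simp: proj_point_def)
    then have "w = (c \<cdot>\<^sub>m A) *\<^sub>v (1 \<cdot>\<^sub>v v)" by (simp only: eq mult_1_right)
    moreover have "c \<cdot>\<^sub>m A \<in> PGL_class n A" using \<open>c \<noteq> 0\<close> cls by blast
    moreover have "1 \<cdot>\<^sub>v v \<in> proj_point v" unfolding proj_point_def by (intro CollectI exI[of _ 1]) simp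
    ultimately show "w \<in> proj_act (PGL_class n A) (proj_point v)"
      unfolding proj_act_def by blast
  qed
qed

text \<open>A generator of finite order needs only its natural powers to exhaust the group, and these are
classes of explicit diagonal matrices.\<close>

lemma orbit_identity_point:
  assumes n: "0 < n" and p: "0 < p" and d: "\<And>j. j < n \<Longrightarrow> d j ^ p = 1"
  shows "orbit ((PGL n)\<lparr>carrier := generate (PGL n) {PGL_class n (mat_diag n d)}\<rparr>) proj_act
      (identity_point (n - 1)) = range (\<lambda>i. proj_point (vec n (\<lambda>j. d j ^ i)))"
proof -
  interpret PGL: group "PGL n" by (rule group_PGL)
  interpret normal "scalar_mats n" "GL n" by (rule normal_scalar_mats)
  let ?D = "mat_diag n d" and ?g = "PGL_class n (mat_diag n d)"
  have "d j \<noteq> 0" if "j < n" for j using d[OF that] p by (auto simp: power_0_left)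
  then have "det ?D \<noteq> 0"
    by (subst det_lower_triangular[of n])
       (auto simp: prod_list_diag_prod mat_diag_def)
  then have D: "?D \<in> carrier (GL n)" by (simp add: carrier_GL)
  have pow: "?g [^]\<^bsub>PGL n\<^esub> i = PGL_class n (mat_diag n (\<lambda>j. d j ^ i))" for i :: nat
    unfolding PGL_class_def PGL_def FactGroup_pow[OF D] mat_diag_pow_GL ..
  have g: "?g \<in> carrier (PGL n)"
    using D by (auto simp: PGL_class_def PGL_def carrier_FactGroup)
  have "mat_diag n (\<lambda>j. d j ^ p) = 1\<^sub>m n"
    using d by (intro eq_matI) (auto simp: mat_diag_def)
  then have "?g [^]\<^bsub>PGL n\<^esub> p = \<one>\<^bsub>PGL n\<^esub>"
    unfolding pow using coset_mult_one[OF subset] by (simp add: PGL_class_def PGL_def)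
  then have "PGL.ord ?g \<noteq> 0" using PGL.pow_eq_id[OF g] p by (metis dvd_0_left_iff less_irrefl)
  then have gen: "generate (PGL n) {?g} = range (\<lambda>i. PGL_class n (mat_diag n (\<lambda>j. d j ^ i)))"
    using PGL.generate_pow_nat[OF g] pow by auto
  have act: "proj_act (PGL_class n (mat_diag n (\<lambda>j. d j ^ i))) (identity_point (n - 1)) =
      proj_point (vec n (\<lambda>j. d j ^ i))" for i
  proof -
    have "mat_diag n (\<lambda>j. d j ^ i) *\<^sub>v vec n (\<lambda>_. 1) = vec n (\<lambda>j. d j ^ i)"
      by (intro eq_vecI) (auto simp: mat_diag_def scalar_prod_def)
    then show ?thesis
      using n by (simp add: identity_point_def proj_act_PGL_class[of _ n])
  qed
  have "orbit ((PGL n)\<lparr>carrier := X\<rparr>) proj_act P = (\<lambda>f. proj_act f P) ` X" for X P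
    by (auto simp: orbit_def)
  then show ?thesis unfolding gen by (simp only: image_image act)
qed

lemma fourier_vec_power: "fourier_vec (\<zeta> ^ m) n h i = fourier_vec \<zeta> n h (m * i)"
  unfolding fourier_vec_def by (intro eq_vecI) (auto simp: power_mult[symmetric] mult.assoc)

lemma range_fourier_points:
  assumes "0 < p" "\<zeta> ^ p = 1"
  shows "range (\<lambda>i. proj_point (fourier_vec \<zeta> n h i)) =
    (\<lambda>i. proj_point (fourier_vec \<zeta> n h i)) ` {..<p}"
proof -
  have "\<zeta> ^ (i mod p * k) = \<zeta> ^ (i * k)" for i k
  proof -
    have "\<zeta> ^ (i * k) = \<zeta> ^ (p * (i div p * k) + i mod p * k)"
      by (metis add_mult_distrib mult.assoc mult_div_mod_eq)
    then show ?thesis by (simp add: power_add power_mult assms(2))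
  qed
  then have "fourier_vec \<zeta> n h (i mod p) = fourier_vec \<zeta> n h i" for i
    by (simp add: fourier_vec_def)
  then have "proj_point (fourier_vec \<zeta> n h i) \<in> (\<lambda>i. proj_point (fourier_vec \<zeta> n h i)) ` {..<p}" for i
    using assms(1) by (intro image_eqI[of _ _ "i mod p"]) auto
  then show ?thesis by blast
qed

lemma orbit_fourier_points:
  assumes "0 < n" "0 < p" "\<zeta> ^ p = 1"
  shows "orbit ((PGL n)\<lparr>carrier := generate (PGL n) {PGL_class n (mat_diag n (\<lambda>j. \<zeta> ^ h j))}\<rparr>)
      proj_act (identity_point (n - 1)) = (\<lambda>i. proj_point (fourier_vec \<zeta> n h i)) ` {..<p}"
proof -
  have "(\<zeta> ^ h j) ^ p = 1" for j
    by (metis assms(3) mult.commute power_mult power_one)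
  then show ?thesis
    unfolding range_fourier_points[OF assms(2,3), symmetric]
    using orbit_identity_point[OF assms(1,2), of "\<lambda>j. \<zeta> ^ h j"]
    by (simp add: fourier_vec_def power_mult[symmetric] mult.commute)
qed

lemma primitive_root_inverse:
  assumes "primitive_root_of_unity p \<zeta>"
  shows "primitive_root_of_unity p (inverse \<zeta>)"
  using assms by (auto simp: primitive_root_of_unity_def power_inverse)

text \<open>Each of \<open>\<zeta>\<close> and its inverse is a power of the other, so inverting the root only reorders the
points.\<close>

lemma inverse_root_fourier_points:
  assumes "0 < p" "\<zeta> ^ p = 1"
  shows "(\<lambda>i. proj_point (fourier_vec (inverse \<zeta>) n h i)) ` {..<p} =
    (\<lambda>i. proj_point (fourier_vec \<zeta> n h i)) ` {..<p}"
proof -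
  have "range (\<lambda>i. proj_point (fourier_vec (\<zeta> ^ m) n h i)) \<subseteq>
      range (\<lambda>i. proj_point (fourier_vec \<zeta> n h i))" for \<zeta> m
    by (auto simp: fourier_vec_power)
  moreover have inv: "inverse \<zeta> = \<zeta> ^ (p - 1)" if "\<zeta> ^ p = 1" for \<zeta> :: complex
  proof -
    have "\<zeta> * \<zeta> ^ (p - 1) = 1" using that assms(1) by (metis power_eq_if gr_implies_not0)
    then show ?thesis by (rule inverse_unique)
  qed
  moreover have "\<zeta> = inverse \<zeta> ^ (p - 1)" "inverse \<zeta> ^ p = 1"
    using inv[of "inverse \<zeta>"] assms(2) by (auto simp: power_inverse)
  ultimately show ?thesis
    using range_fourier_points[OF assms] range_fourier_points[of p "inverse \<zeta>"] assms
    by (metis subset_antisym)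
qed

section \<open>Association of complementary row blocks\<close>

lemma fourier_point_in_proj_space:
  "\<zeta> \<noteq> 0 \<Longrightarrow> proj_point (fourier_vec \<zeta> (m + 1) h i) \<in> proj_space m"
  unfolding proj_space_def
  by (intro imageI) (auto simp: fourier_vec_def vec_eq_iff)

lemma fourier_rows_orthogonal:
  assumes \<zeta>: "primitive_root_of_unity p \<zeta>" and "h < p" "k < p" "h \<noteq> k"
  shows "(\<Sum>i<p. \<zeta> ^ (i * h) * inverse \<zeta> ^ (i * k)) = 0"
proof -
  let ?w = "\<zeta> ^ h * inverse \<zeta> ^ k"
  have p: "\<zeta> ^ p = 1" "\<zeta> \<noteq> 0" using \<zeta> by (auto simp: primitive_root_of_unity_def power_0_left)
  have "\<zeta> ^ h \<noteq> \<zeta> ^ k" using primitive_root_power_inj[OF \<zeta>] assms by (auto simp: inj_on_def)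
  then have "?w \<noteq> 1" using p by (simp add: power_inverse field_simps)
  have "?w ^ p = (\<zeta> ^ p) ^ h * inverse ((\<zeta> ^ p) ^ k)"
    by (simp add: power_mult_distrib power_inverse power_mult[symmetric] mult.commute)
  then have "?w ^ p = 1" using p by simp
  moreover have "(\<Sum>i<p. \<zeta> ^ (i * h) * inverse \<zeta> ^ (i * k)) = (\<Sum>i<p. ?w ^ i)"
    by (simp add: power_mult_distrib power_mult[symmetric] mult.commute)
  ultimately show ?thesis using geometric_sum[OF \<open>?w \<noteq> 1\<close>] by simp
qed

text \<open>The inverse root in the second set is a choice of ordering of that set: it turns the products
of coordinates into powers of \<open>\<zeta> ^ (h r - k s)\<close>, and \<open>h r - k s\<close> is never divisible by \<open>p\<close>.\<close>

lemma associated_fourier_points: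
  assumes "prime p" and \<zeta>: "primitive_root_of_unity p \<zeta>" and a: "2 \<le> a" "a \<le> p - 2"
    and h: "inj_on h {..<a}" "h ` {..<a} \<subseteq> {..<p}"
    and k: "inj_on k {..<p - a}" "k ` {..<p - a} \<subseteq> {..<p}"
    and disj: "h ` {..<a} \<inter> k ` {..<p - a} = {}"
  shows "associated_point_sets p (a - 1)
    ((\<lambda>i. proj_point (fourier_vec \<zeta> a h i)) ` {..<p})
    ((\<lambda>i. proj_point (fourier_vec (inverse \<zeta>) (p - a) k i)) ` {..<p})"
proof -
  let ?P = "\<lambda>i. proj_point (fourier_vec \<zeta> a h i)"
    and ?Q = "\<lambda>i. proj_point (fourier_vec (inverse \<zeta>) (p - a) k i)"
  let ?A = "map ?P [0..<p]" and ?B = "map ?Q [0..<p]"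
  have \<zeta>': "primitive_root_of_unity p (inverse \<zeta>)" by (rule primitive_root_inverse[OF \<zeta>])
  have nz: "\<zeta> \<noteq> 0" using \<zeta> by (auto simp: primitive_root_of_unity_def power_0_left)
  have dims: "a - 1 + 1 = a" "p - (a - 1) - 2 = p - a - 1" "p - a - 1 + 1 = p - a" "2 \<le> p - a"
    using a by auto
  have sets: "set ?A = ?P ` {..<p}" "set ?B = ?Q ` {..<p}" by (auto simp: atLeast0LessThan)
  have "associated_ordered p (a - 1) ?A ?B"
    unfolding associated_ordered_def dims sets
  proof (intro conjI)
    show "a - 1 + 2 \<le> p" using a by simp
    show "distinct ?A" "distinct ?B"
      using fourier_points_inj[OF assms(1) \<zeta> a(1) h] fourier_points_inj[OF assms(1) \<zeta>' dims(4) k]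
      by (auto simp: distinct_map atLeast0LessThan)
    show "?P ` {..<p} \<subseteq> proj_space (a - 1)" "?Q ` {..<p} \<subseteq> proj_space (p - a - 1)"
      using fourier_point_in_proj_space[of \<zeta> "a - 1"] nz
        fourier_point_in_proj_space[of "inverse \<zeta>" "p - a - 1"] unfolding dims by auto
    show "general_position (a - 1) (?P ` {..<p})"
      using general_position_fourier_points[OF assms(1) \<zeta>, of "a - 1" h] h a unfolding dims by simp
    show "general_position (p - a - 1) (?Q ` {..<p})"
      using general_position_fourier_points[OF assms(1) \<zeta>', of "p - a - 1" k] k dims(4) unfolding dims by simp
    let ?M = "mat a p (\<lambda>(r,i). \<zeta> ^ (i * h r))" and ?N = "mat (p - a) p (\<lambda>(s,i). inverse \<zeta> ^ (i * k s))"
    have colM: "col ?M i = fourier_vec \<zeta> a h i" if "i < p" for i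
      using that by (intro eq_vecI) (auto simp: fourier_vec_def)
    have colN: "col ?N i = fourier_vec (inverse \<zeta>) (p - a) k i" if "i < p" for i
      using that by (intro eq_vecI) (auto simp: fourier_vec_def)
    have "?M * mat_diag p (\<lambda>_. 1) * transpose_mat ?N = 0\<^sub>m a (p - a)"
    proof (rule eq_matI)
      fix r s assume "r < dim_row (0\<^sub>m a (p - a) :: complex mat)" "s < dim_col (0\<^sub>m a (p - a) :: complex mat)"
      then have rs: "r < a" "s < p - a" by auto
      then have "h r < p" "k s < p" "h r \<noteq> k s" using h k disj by (auto simp: image_subset_iff)
      then show "(?M * mat_diag p (\<lambda>_. 1) * transpose_mat ?N) $$ (r,s) = 0\<^sub>m a (p - a) $$ (r,s)"
        using rs fourier_rows_orthogonal[OF \<zeta>, of "h r" "k s"]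
        by (simp add: scalar_prod_def atLeast0LessThan)
    qed auto
    then show "\<exists>M N \<delta>. coordinate_matrix (a - 1) ?A M \<and> coordinate_matrix (p - a - 1) ?B N \<and>
        (\<forall>i<p. \<delta> i \<noteq> 0) \<and> M * mat_diag p \<delta> * transpose_mat N = 0\<^sub>m a (p - a)"
      using a colM colN self_in_proj_point unfolding coordinate_matrix_def dims
      by (intro exI[of _ ?M] exI[of _ ?N] exI[of _ "\<lambda>_. 1"]) auto
  qed auto
  then show ?thesis unfolding associated_point_sets_def using sets by blast
qed

section \<open>The orbits of associated subgroups\<close>

theorem theorem6:
  fixes p a :: nat and \<epsilon> :: complex
    and H K :: "complex mat set set" and T V :: "complex vec set set"
  assumes "prime p" and "p \<ge> 5"
    and "2 \<le> a" and "a \<le> p - 2"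
    and "primitive_root_of_unity p \<epsilon>"
    and "subgroup H (PGL a)" and "card H = p"
    and "admissible (a - 1) H" and "diagonal_form p a H"
    and "subgroup K (PGL (p - a))" and "card K = p"
    and "diagonal_form p (p - a) K"
    and "associated_subgroup p \<epsilon> a H K"
    and "T = orbit ((PGL a)\<lparr>carrier := H\<rparr>) proj_act (identity_point (a - 1))"
    and "V = orbit ((PGL (p - a))\<lparr>carrier := K\<rparr>) proj_act (identity_point (p - a - 1))"
  shows "associated_point_sets p (a - 1) T V"
proof -
  obtain h k where h: "inj_on h {..<a}" "h ` {..<a} \<subseteq> {..<p}"
    and k: "bij_betw k {..<p - a} ({..<p} - h ` {..<a})"
    and H: "H = generate (PGL a) {PGL_class a (mat_diag a (\<lambda>i. \<epsilon> ^ h i))}"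
    and K: "K = generate (PGL (p - a)) {PGL_class (p - a) (mat_diag (p - a) (\<lambda>j. \<epsilon> ^ k j))}"
    using assms(13) unfolding associated_subgroup_def by blast
  have p: "0 < p" "\<epsilon> ^ p = 1" using assms(5) by (auto simp: primitive_root_of_unity_def)
  have "T = (\<lambda>i. proj_point (fourier_vec \<epsilon> a h i)) ` {..<p}"
    unfolding assms(14) H using assms(3) p by (intro orbit_fourier_points) auto
  moreover have "V = (\<lambda>i. proj_point (fourier_vec (inverse \<epsilon>) (p - a) k i)) ` {..<p}"
    unfolding assms(15) K inverse_root_fourier_points[OF p]
    using assms(2,4) p by (intro orbit_fourier_points) auto
  ultimately show ?thesis
    using associated_fourier_points[OF assms(1,5,3,4) h, of k] k
    by (auto simp: bij_betw_def)
qed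

end
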